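(* For each $w\in W/W_P$, the irreducible component $Z_{P,w}$ of $Z_P$ is contained in the closed subspace of $Z_P$ where $\mathrm{Ad}(g_1^{-1})\nu\in\mathfrak{n}_Q$ if and only if $ww_0\cdot\lambda$ is a dominant weight for $\mathfrak{m}_Q$.
   Context: $L$ is a finite extension of $\mathbb{Q}_p$, $\Sigma_p$ a finite index set (the set of embeddings into $L$ of the $p$-adic completions of a totally real field), $G=\prod_{\tau\in\Sigma_p}\mathrm{GL}_{n/L}$, $T\subset B$ the diagonal torus and the upper-triangular Borel subgroup, $W=\prod_{\tau\in\Sigma_p}\mathcal{S}_n$ the Weyl group, $w_0$ its longest element. $\lambda=(\lambda_{\tau,i})\in\prod_{\tau\in\Sigma_p}\mathbb{Z}^n$ is a weight with $\lambda_{\tau,i}-\lambda_{\tau,i+1}\ge-1$ for all $\tau$ and $1\le i\le n-1$. $w\cdot\mu=w(\mu+\rho_0)-\rho_0$ is the dot action, $\rho_0$ the half sum of the positive roots with respect to $B$. $P\supset B$ is the standard parabolic subgroup such that the Weyl group $W_P$ of its standard Levi subgroup is the stabilizer of $w_0\cdot\lambda$ under the dot action; thus $ww_0\cdot\lambda$ depends only on $w\in W/W_P$. $Q\supset B$ is any standard parabolic subgroup, with Lie algebra $\mathfrak{q}=\mathfrak{m}_Q+\mathfrak{n}_Q$, $\mathfrak{m}_Q$ the block-diagonal Levi subalgebra and $\mathfrak{n}_Q$ the nilpotent radical. A weight $\mu$ is dominant for $\mathfrak{m}_Q$ if $\langle\alpha^\vee,\mu\rangle\ge0$ for every simple root $\alpha$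 of $\mathfrak m_Q$ (positive with respect to $B$). $\mathfrak{g},\mathfrak{p}$ are the Lie algebras of $G,P$ and $\mathfrak{u}$ the nilpotent radical of the Lie algebra of $B$. The generalized Steinberg variety is $$Z_P=\{(\nu,g_1B,g_2P)\in\mathfrak g\times G/B\times G/P\mid\mathrm{Ad}(g_1^{-1})\nu\in\mathfrak u,\ \mathrm{Ad}(g_2^{-1})\nu\in\mathfrak p\},$$ and for $w\in W/W_P$, $Z_{P,w}$ is the Zariski closure (with reduced structure) of $\{(\nu,g_1B,g_2P)\in Z_P\mid g_1^{-1}g_2\in BwP\}$; these are the irreducible components of $Z_P$. *)

theory Defs
  imports
    "HOL-Analysis.Analysis"
    "HOL-Algebra.Algebraic_Closure_Type"
    "HOL-Algebra.Embedded_Algebras"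
    "HOL-Combinatorics.Transposition"
begin

definition padic_norm :: "nat \<Rightarrow> rat \<Rightarrow> real" where
  "padic_norm p x = (if x = 0 then 0 else
     real p powi (int (multiplicity (int p) (snd (quotient_of x)))
                - int (multiplicity (int p) (fst (quotient_of x)))))"

text \<open>\<open>K\<close> is a completion of the rationals for the \<open>p\<close>-adic absolute value; \<open>v\<close> is the extended
  absolute value.\<close>

definition is_padic_field :: "nat \<Rightarrow> 'l::field_char_0 set \<Rightarrow> bool" where
  "is_padic_field p K \<longleftrightarrow> subfield K ring_of_type_algebra \<and>
     (\<exists>v. (\<forall>x\<in>K. v x \<ge> 0 \<and> (v x = 0 \<longleftrightarrow> x = 0)) \<and>
          (\<forall>x\<in>K. \<forall>y\<in>K. v (x * y) = v x * v y \<and> v (x + y) \<le> v x + v y) \<and>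
          (\<forall>r. v (of_rat r) = padic_norm p r) \<and>
          (\<forall>x\<in>K. \<forall>\<epsilon>>0. \<exists>r. v (x - of_rat r) < \<epsilon>) \<and>
          Metric_space.mcomplete K (\<lambda>x y. v (x - y)))"

definition finite_extension_of_Qp :: "nat \<Rightarrow> 'l::field_char_0 itself \<Rightarrow> bool" where
  "finite_extension_of_Qp p _ \<longleftrightarrow>
     (\<exists>K. is_padic_field p (K :: 'l set) \<and> ring.finite_dimension ring_of_type_algebra K (UNIV :: 'l set))"


text \<open>The index set \<open>{1..n}\<close> is a finite linearly ordered type \<open>'n\<close> with \<open>n = CARD('n)\<close>, and
  \<open>\<Sigma>\<^sub>p\<close> is a finite type \<open>'s\<close>. The triple \<open>(\<tau>, i, j)\<close> with \<open>i < j\<close> is the positive root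
  \<open>e\<^sub>i - e\<^sub>j\<close> of the factor \<open>\<tau>\<close>. Weights have rational coordinates because of \<open>\<rho>\<^sub>0\<close>.\<close>

type_synonym ('s, 'n) root = "'s \<times> 'n \<times> 'n"
type_synonym ('s, 'n) weight = "'s \<Rightarrow> 'n \<Rightarrow> rat"
type_synonym ('s, 'n) weyl = "'s \<Rightarrow> 'n \<Rightarrow> 'n"

definition pos_roots :: "('s, 'n::linorder) root set" where
  "pos_roots = {(\<tau>, i, j). i < j}"

definition simple_roots :: "('s, 'n::linorder) root set" where
  "simple_roots = {(\<tau>, i, j). i < j \<and> \<not> (\<exists>k. i < k \<and> k < j)}"

definition root_weight :: "('s, 'n) root \<Rightarrow> ('s, 'n) weight" where
  "root_weight = (\<lambda>(\<tau>, i, j) \<sigma> k. if \<sigma> = \<tau> then of_bool (k = i) - of_bool (k = j) else 0)"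

definition coroot_pairing :: "('s, 'n) root \<Rightarrow> ('s, 'n) weight \<Rightarrow> rat" where
  "coroot_pairing = (\<lambda>(\<tau>, i, j) \<mu>. \<mu> \<tau> i - \<mu> \<tau> j)"

definition half_sum :: "('s::finite, 'n::{finite,linorder}) weight" where
  "half_sum = (\<lambda>\<tau> i. (\<Sum>\<alpha>\<in>pos_roots. root_weight \<alpha> \<tau> i) / 2)"

definition weyl_group :: "('s, 'n) weyl set" where
  "weyl_group = {w. \<forall>\<tau>. bij (w \<tau>)}"

definition weyl_mult :: "('s, 'n) weyl \<Rightarrow> ('s, 'n) weyl \<Rightarrow> ('s, 'n) weyl" where
  "weyl_mult v w = (\<lambda>\<tau>. v \<tau> \<circ> w \<tau>)"

definition reflection :: "('s, 'n) root \<Rightarrow> ('s, 'n) weyl" where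
  "reflection = (\<lambda>(\<tau>, i, j) \<sigma>. if \<sigma> = \<tau> then Transposition.transpose i j else id)"

definition weyl_length :: "('s, 'n::linorder) weyl \<Rightarrow> nat" where
  "weyl_length w = (LEAST k. \<exists>\<alpha>s. length \<alpha>s = k \<and> set \<alpha>s \<subseteq> simple_roots \<and>
     w = foldr weyl_mult (map reflection \<alpha>s) (\<lambda>\<tau>. id))"

definition longest :: "('s, 'n::linorder) weyl" where
  "longest = (ARG_MAX weyl_length w. w \<in> weyl_group)"

definition weyl_act :: "('s, 'n) weyl \<Rightarrow> ('s, 'n) weight \<Rightarrow> ('s, 'n) weight" where
  "weyl_act w \<mu> = (\<lambda>\<tau> i. \<mu> \<tau> (inv_into UNIV (w \<tau>) i))"

definition dot_act ::
  "('s, 'n) weyl \<Rightarrow> ('s, 'n) weight \<Rightarrow> ('s::finite, 'n::{finite,linorder}) weight" where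
  "dot_act w \<mu> = (\<lambda>\<tau> i. weyl_act w (\<lambda>\<sigma> j. \<mu> \<sigma> j + half_sum \<sigma> j) \<tau> i - half_sum \<tau> i)"

definition dot_stabilizer ::
  "('s::finite, 'n::{finite,linorder}) weight \<Rightarrow> ('s, 'n) weyl set" where
  "dot_stabilizer \<mu> = {w \<in> weyl_group. dot_act w \<mu> = \<mu>}"

definition int_weight :: "('s \<Rightarrow> 'n \<Rightarrow> int) \<Rightarrow> ('s, 'n) weight" where
  "int_weight lam = (\<lambda>\<tau> i. of_int (lam \<tau> i))"


text \<open>The group and the Lie algebras are given by their points over a field \<open>'k\<close>. A standard parabolic
  subgroup is given by the set \<open>I \<subseteq> simple_roots\<close> of simple roots of its standard Levi subgroup:
  two indices lie in the same diagonal block iff all simple roots between them belong to \<open>I\<close>.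
  Thus \<open>I = {}\<close> gives the Borel subgroup \<open>B\<close>.\<close>

type_synonym ('s, 'k, 'n) mats = "'s \<Rightarrow> 'k^'n^'n"

definition GL :: "('s, 'k::field, 'n::finite) mats set" where
  "GL = {g. \<forall>\<tau>. invertible (g \<tau>)}"

definition gmult :: "('s, 'k, 'n) mats \<Rightarrow> ('s, 'k, 'n) mats \<Rightarrow> ('s, 'k::field, 'n::finite) mats" where
  "gmult g h = (\<lambda>\<tau>. g \<tau> ** h \<tau>)"

definition ginv :: "('s, 'k, 'n) mats \<Rightarrow> ('s, 'k::field, 'n::finite) mats" where
  "ginv g = (\<lambda>\<tau>. matrix_inv (g \<tau>))"

definition Ad :: "('s, 'k, 'n) mats \<Rightarrow> ('s, 'k, 'n) mats \<Rightarrow> ('s, 'k::field, 'n::finite) mats" where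
  "Ad g x = gmult (gmult g x) (ginv g)"

definition lcoset :: "('s, 'k, 'n) mats \<Rightarrow> ('s, 'k, 'n) mats set \<Rightarrow> ('s, 'k::field, 'n::finite) mats set" where
  "lcoset g H = gmult g ` H"

definition same_block :: "('s, 'n::linorder) root set \<Rightarrow> 's \<Rightarrow> 'n \<Rightarrow> 'n \<Rightarrow> bool" where
  "same_block I \<tau> i j \<longleftrightarrow>
     (\<forall>a b. (\<tau>, a, b) \<in> simple_roots \<and> min i j \<le> a \<and> b \<le> max i j \<longrightarrow> (\<tau>, a, b) \<in> I)"

definition lie_parabolic :: "('s, 'n::{finite,linorder}) root set \<Rightarrow> ('s, 'k::field, 'n) mats set" where
  "lie_parabolic I = {x. \<forall>\<tau> i j. x \<tau> $ i $ j \<noteq> 0 \<longrightarrow> i \<le> j \<or> same_block I \<tau> i j}"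

definition lie_nilradical :: "('s, 'n::{finite,linorder}) root set \<Rightarrow> ('s, 'k::field, 'n) mats set" where
  "lie_nilradical I = {x. \<forall>\<tau> i j. x \<tau> $ i $ j \<noteq> 0 \<longrightarrow> i < j \<and> \<not> same_block I \<tau> i j}"

definition parabolic :: "('s, 'n::{finite,linorder}) root set \<Rightarrow> ('s, 'k::field, 'n) mats set" where
  "parabolic I = GL \<inter> lie_parabolic I"

abbreviation borel_subgroup :: "('s, 'k::field, 'n::{finite,linorder}) mats set" where
  "borel_subgroup \<equiv> parabolic {}"

text \<open>The Weyl group of the standard Levi subgroup, i.e. of a product of groups \<open>GL\<^sub>m\<close> over the
  diagonal blocks.\<close>

definition levi_weyl_group :: "('s, 'n::linorder) root set \<Rightarrow> ('s, 'n) weyl set" where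
  "levi_weyl_group I = {w \<in> weyl_group. \<forall>\<tau> i. same_block I \<tau> i (w \<tau> i)}"

text \<open>The simple roots of the standard Levi subalgebra for \<open>I\<close> are the elements of \<open>I\<close>.\<close>

definition levi_dominant :: "('s, 'n) root set \<Rightarrow> ('s, 'n) weight \<Rightarrow> bool" where
  "levi_dominant I \<mu> \<longleftrightarrow> (\<forall>\<alpha>\<in>I. coroot_pairing \<alpha> \<mu> \<ge> 0)"

text \<open>The permutation matrix sending the basis vector \<open>e\<^sub>j\<close> to \<open>e\<^sub>k\<close> with \<open>k = w \<tau> j\<close>. With this
  lift, the action of the normalizer of \<open>T\<close> on characters is \<^const>\<open>weyl_act\<close>.\<close>

definition weyl_lift :: "('s, 'n) weyl \<Rightarrow> ('s, 'k::field, 'n::finite) mats" where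
  "weyl_lift w = (\<lambda>\<tau>. \<chi> i j. of_bool (i = w \<tau> j))"

definition double_coset ::
  "('s, 'n::{finite,linorder}) root set \<Rightarrow> ('s, 'n) weyl \<Rightarrow> ('s, 'k::field, 'n) mats set" where
  "double_coset I w = {gmult (gmult b (weyl_lift w)) q | b q. b \<in> borel_subgroup \<and> q \<in> parabolic I}"


text \<open>An \<open>L\<close>-scheme of finite type is represented by its points over an algebraic closure of \<open>L\<close>,
  with the topology whose closed sets are the closed subschemes defined over \<open>L\<close>. Closed
  reduced subschemes, their closures and the inclusions between them are determined by these
  points. Regular functions on the affine variety \<open>\<gg> \<times> G \<times> G\<close> are the polynomials with
  coefficients in \<open>L\<close> in the matrix entries and the inverses of the determinants of the group
  elements.\<close>

type_synonym ('s, 'k, 'n) triple = "('s, 'k, 'n) mats \<times> ('s, 'k, 'n) mats \<times> ('s, 'k, 'n) mats"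
type_synonym ('s, 'k, 'n) flag_point =
  "('s, 'k, 'n) mats \<times> ('s, 'k, 'n) mats set \<times> ('s, 'k, 'n) mats set"

inductive_set regular_functions ::
  "(('s, 'l::field alg_closure, 'n::finite) triple \<Rightarrow> 'l alg_closure) set" where
  const: "(\<lambda>_. to_ac c) \<in> regular_functions"
| entry_nu: "(\<lambda>(\<nu>, g, h). \<nu> \<tau> $ i $ j) \<in> regular_functions"
| entry_g: "(\<lambda>(\<nu>, g, h). g \<tau> $ i $ j) \<in> regular_functions"
| entry_h: "(\<lambda>(\<nu>, g, h). h \<tau> $ i $ j) \<in> regular_functions"
| inv_det_g: "(\<lambda>(\<nu>, g, h). inverse (det (g \<tau>))) \<in> regular_functions"
| inv_det_h: "(\<lambda>(\<nu>, g, h). inverse (det (h \<tau>))) \<in> regular_functions"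
| add: "f1 \<in> regular_functions \<Longrightarrow> f2 \<in> regular_functions \<Longrightarrow> (\<lambda>x. f1 x + f2 x) \<in> regular_functions"
| mult: "f1 \<in> regular_functions \<Longrightarrow> f2 \<in> regular_functions \<Longrightarrow> (\<lambda>x. f1 x * f2 x) \<in> regular_functions"

definition zariski_triples :: "('s, 'l::field alg_closure, 'n::finite) triple topology" where
  "zariski_triples = topology_generated_by
     {{x \<in> UNIV \<times> GL \<times> GL. f x \<noteq> 0} | f. f \<in> regular_functions}"

definition quotient_topology :: "'a topology \<Rightarrow> ('a \<Rightarrow> 'b) \<Rightarrow> 'b topology" where
  "quotient_topology T q =
     topology (\<lambda>U. U \<subseteq> q ` topspace T \<and> openin T {x \<in> topspace T. q x \<in> U})"

lemma openin_quotient_topology: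
  "openin (quotient_topology T q) U \<longleftrightarrow>
     U \<subseteq> q ` topspace T \<and> openin T {x \<in> topspace T. q x \<in> U}"
proof -
  have "istopology (\<lambda>U. U \<subseteq> q ` topspace T \<and> openin T {x \<in> topspace T. q x \<in> U})"
    unfolding istopology_def
  proof (rule conjI; intro allI impI)
    fix S V
    assume S: "S \<subseteq> q ` topspace T \<and> openin T {x \<in> topspace T. q x \<in> S}"
      and V: "V \<subseteq> q ` topspace T \<and> openin T {x \<in> topspace T. q x \<in> V}"
    have "{x \<in> topspace T. q x \<in> S \<inter> V} =
        {x \<in> topspace T. q x \<in> S} \<inter> {x \<in> topspace T. q x \<in> V}"
      by auto
    then show "S \<inter> V \<subseteq> q ` topspace T \<and> openin T {x \<in> topspace T. q x \<in> S \<inter> V}"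
      using S V by (simp only: openin_Int le_infI1 simp_thms)
  next
    fix \<K>
    assume K: "\<forall>U\<in>\<K>. U \<subseteq> q ` topspace T \<and> openin T {x \<in> topspace T. q x \<in> U}"
    have "{x \<in> topspace T. q x \<in> \<Union>\<K>} = (\<Union>U\<in>\<K>. {x \<in> topspace T. q x \<in> U})"
      by blast
    moreover have "openin T (\<Union>U\<in>\<K>. {x \<in> topspace T. q x \<in> U})"
      using K by blast
    ultimately show "\<Union>\<K> \<subseteq> q ` topspace T \<and> openin T {x \<in> topspace T. q x \<in> \<Union>\<K>}"
      using K by (simp add: Sup_le_iff)
  qed
  then show ?thesis
    unfolding quotient_topology_def by (simp add: topology_inverse')
qed

lemma quotient_map_quotient_topology: "quotient_map T (quotient_topology T q) q"
proof -
  let ?Y = "quotient_topology T q"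
  have "{x \<in> topspace T. q x \<in> q ` topspace T} = topspace T"
    by blast
  then have "openin ?Y (q ` topspace T)"
    by (simp add: openin_quotient_topology)
  moreover have "topspace ?Y \<subseteq> q ` topspace T"
    using openin_topspace[of ?Y] by (simp only: openin_quotient_topology)
  ultimately have "topspace ?Y = q ` topspace T"
    using openin_subset by blast
  then show ?thesis
    by (simp add: quotient_map_def openin_quotient_topology)
qed

text \<open>\<open>G \<rightarrow> G/B\<close> and \<open>G \<rightarrow> G/P\<close> are open surjections of varieties, so \<open>\<gg> \<times> G/B \<times> G/P\<close> carries
  the quotient topology.\<close>

definition flag_proj ::
  "('s, 'n::{finite,linorder}) root set \<Rightarrow> ('s, 'k::field, 'n) triple \<Rightarrow> ('s, 'k, 'n) flag_point" where
  "flag_proj I = (\<lambda>(\<nu>, g1, g2). (\<nu>, lcoset g1 borel_subgroup, lcoset g2 (parabolic I)))"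

definition zariski_flag ::
  "('s, 'n::{finite,linorder}) root set \<Rightarrow> ('s, 'l::field alg_closure, 'n) flag_point topology" where
  "zariski_flag I = quotient_topology zariski_triples (flag_proj I)"


definition steinberg ::
  "('s, 'n::{finite,linorder}) root set \<Rightarrow> ('s, 'k::field, 'n) flag_point set" where
  "steinberg I = {(\<nu>, lcoset g1 borel_subgroup, lcoset g2 (parabolic I)) | \<nu> g1 g2.
     g1 \<in> GL \<and> g2 \<in> GL \<and>
     Ad (ginv g1) \<nu> \<in> lie_nilradical {} \<and> Ad (ginv g2) \<nu> \<in> lie_parabolic I}"

definition steinberg_cell ::
  "('s, 'n::{finite,linorder}) root set \<Rightarrow> ('s, 'n) weyl \<Rightarrow> ('s, 'k::field, 'n) flag_point set" where
  "steinberg_cell I w = {(\<nu>, lcoset g1 borel_subgroup, lcoset g2 (parabolic I)) | \<nu> g1 g2.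
     g1 \<in> GL \<and> g2 \<in> GL \<and>
     Ad (ginv g1) \<nu> \<in> lie_nilradical {} \<and> Ad (ginv g2) \<nu> \<in> lie_parabolic I \<and>
     gmult (ginv g1) g2 \<in> double_coset I w}"

definition steinberg_component ::
  "('s, 'n::{finite,linorder}) root set \<Rightarrow> ('s, 'n) weyl \<Rightarrow>
   ('s, 'l::field alg_closure, 'n) flag_point set" where
  "steinberg_component I w =
     subtopology (zariski_flag I) (steinberg I) closure_of (steinberg_cell I w)"

definition steinberg_nilradical_locus ::
  "('s, 'n::{finite,linorder}) root set \<Rightarrow> ('s, 'n) root set \<Rightarrow>
   ('s, 'k::field, 'n) flag_point set" where
  "steinberg_nilradical_locus I J = {(\<nu>, lcoset g1 borel_subgroup, lcoset g2 (parabolic I)) | \<nu> g1 g2.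
     g1 \<in> GL \<and> g2 \<in> GL \<and>
     Ad (ginv g1) \<nu> \<in> lie_nilradical {} \<and> Ad (ginv g2) \<nu> \<in> lie_parabolic I \<and>
     Ad (ginv g1) \<nu> \<in> lie_nilradical J}"

end

theory Submission
  imports Defs
begin

text \<open>The locus is closed, so the component lies in it iff the cell does. After translating \<open>g\<^sub>1\<close> by
  an element of \<open>B\<close>, the elements \<open>Ad(g\<^sub>1\<^sup>-\<^sup>1)\<nu>\<close> occurring in the cell of \<open>w\<close> fill
  \<open>\<uu> \<inter> Ad(w)\<pp>\<close>, which is spanned by root spaces; since \<open>\<nn>\<^sub>Q\<close> is \<open>B\<close>-stable, the inclusion says that
  \<open>w\<^sup>-\<^sup>1\<alpha>\<close> is not a root of \<open>\<pp>\<close> for any positive root \<open>\<alpha>\<close> of \<open>\<mm>\<^sub>Q\<close>, and simple \<open>\<alpha>\<close> suffice.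
  On the other side \<open>\<mu> = w\<^sub>0(\<lambda> + \<rho>\<^sub>0)\<close> is antidominant with stabilizer \<open>W\<^sub>P\<close>, so
  \<open>\<langle>\<beta>\<^sup>\<or>, \<mu>\<rangle> > 0\<close> iff \<open>\<beta>\<close> is not a root of \<open>\<pp>\<close>. By integrality, and as \<open>\<langle>\<alpha>\<^sup>\<or>, \<rho>\<^sub>0\<rangle> = 1\<close> for
  simple \<open>\<alpha>\<close>, dominance of \<open>w\<mu> - \<rho>\<^sub>0\<close> at \<open>\<alpha>\<close> says \<open>\<langle>(w\<^sup>-\<^sup>1\<alpha>)\<^sup>\<or>, \<mu>\<rangle> > 0\<close>.\<close>

section \<open>Adjacent indices and diagonal blocks\<close>

text \<open>Induction on the size of the interval: an interior point splits it into two smaller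
  intervals, and transitivity of \<open>R\<close> glues them. This is the passage from simple roots
  to all positive roots; the bounds in \<open>step\<close> keep the chain inside one diagonal
  block.\<close>

lemma adjacent_chain:
  fixes i j :: "'n::{finite,linorder}"
  assumes "i < j"
    and step: "\<And>a b. a < b \<Longrightarrow> \<not> (\<exists>k. a < k \<and> k < b) \<Longrightarrow> i \<le> a \<Longrightarrow> b \<le> j \<Longrightarrow> R a b"
    and trans: "\<And>a b c. R a b \<Longrightarrow> R b c \<Longrightarrow> R a c"
  shows "R i j"
  using assms(1) step
proof (induction "card {i..j}" arbitrary: i j rule: less_induct)
  case less
  show ?case
  proof (cases "\<exists>k. i < k \<and> k < j")
    case False
    then show ?thesis using less.prems by blast
  next
    case True
    then obtain k where k: "i < k" "k < j" by blast
    have "{i..k} \<subset> {i..j}" "{k..j} \<subset> {i..j}"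
      using k by auto
    then have card: "card {i..k} < card {i..j}" "card {k..j} < card {i..j}"
      by (auto intro: psubset_card_mono)
    have "R i k"
      by (rule less.hyps[OF card(1) k(1)], rule less.prems(2)) (use k in auto)
    moreover have "R k j"
      by (rule less.hyps[OF card(2) k(2)], rule less.prems(2)) (use k in auto)
    ultimately show ?thesis by (rule trans)
  qed
qed

section \<open>Diagonal blocks of a standard parabolic\<close>

lemma same_block_refl [simp]: "same_block I \<tau> i i"
  by (auto simp: same_block_def simple_roots_def)

lemma same_block_commute: "same_block I \<tau> i j \<longleftrightarrow> same_block I \<tau> j i"
  by (simp add: same_block_def min.commute max.commute)

lemma same_block_subinterval:
  assumes "same_block I \<tau> i j" "min i j \<le> min k l" "max k l \<le> max i j"
  shows "same_block I \<tau> k l"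
  using assms unfolding same_block_def by (meson order_trans)

text \<open>No index lies strictly between adjacent indices, so every simple root between
  \<open>i\<close> and \<open>k\<close> lies entirely on one side of \<open>j\<close> and is covered
  by one of the two hypotheses.\<close>

lemma same_block_trans:
  assumes "same_block I \<tau> i j" "same_block I \<tau> j k"
  shows "same_block I \<tau> i k"
  unfolding same_block_def
proof (intro allI impI)
  fix a b assume ab: "(\<tau>, a, b) \<in> simple_roots \<and> min i k \<le> a \<and> b \<le> max i k"
  then have "a < b" "j \<le> a \<or> b \<le> j"
    unfolding simple_roots_def by (auto simp del: not_ex) (meson not_le)
  then have "min i j \<le> a \<and> b \<le> max i j \<or> min j k \<le> a \<and> b \<le> max j k"
    using ab by (auto simp: min_def max_def split: if_splits)
  then show "(\<tau>, a, b) \<in> I"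
    using ab assms unfolding same_block_def by blast
qed

text \<open>The interval between adjacent indices contains no simple root but their own.\<close>

lemma same_block_simple_root:
  assumes "(\<tau>, i, j) \<in> simple_roots"
  shows "same_block I \<tau> i j \<longleftrightarrow> (\<tau>, i, j) \<in> I"
proof -
  have "a = i \<and> b = j" if "(\<tau>, a, b) \<in> simple_roots" "min i j \<le> a" "b \<le> max i j" for a b
    using that assms by (auto simp: simple_roots_def) (metis le_less_trans less_le_trans order_le_less)+
  then show ?thesis
    using assms unfolding same_block_def by (auto simp: simple_roots_def)
qed

text \<open>The matrix positions allowed in \<pp>: the diagonal ones and those of the roots of
  \<pp>. In each factor this is a total preorder on indices, and its complement is transitive as
  well.\<close>

definition in_parabolic :: "('s, 'n::linorder) root set \<Rightarrow> 's \<Rightarrow> 'n \<Rightarrow> 'n \<Rightarrow> bool" where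
  "in_parabolic I \<tau> i j \<longleftrightarrow> i \<le> j \<or> same_block I \<tau> i j"

lemma in_parabolic_refl [simp]: "in_parabolic I \<tau> i i"
  by (simp add: in_parabolic_def)

text \<open>If \<open>k < i\<close>, the two steps cannot both go up. When one of them does, the
  other goes down across the whole interval from \<open>k\<close> to \<open>i\<close>, so its block
  contains both ends.\<close>

lemma in_parabolic_trans:
  assumes "in_parabolic I \<tau> i j" "in_parabolic I \<tau> j k"
  shows "in_parabolic I \<tau> i k"
proof (cases "i \<le> k")
  case False
  consider "i \<le> j" "same_block I \<tau> j k" | "same_block I \<tau> i j" "j \<le> k"
    | "same_block I \<tau> i j" "same_block I \<tau> j k"
    using assms False unfolding in_parabolic_def by fastforce
  then have "same_block I \<tau> i k"
  proof cases
    case 1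
    then show ?thesis
      by (rule_tac same_block_subinterval) (use 1 False in auto)
  next
    case 2
    then show ?thesis
      by (rule_tac same_block_subinterval) (use 2 False in auto)
  qed (rule same_block_trans)
  then show ?thesis by (simp add: in_parabolic_def)
qed (simp add: in_parabolic_def)

text \<open>Both steps strictly descend, so \<open>j\<close> lies between \<open>k\<close> and
  \<open>i\<close>; a block containing the two ends would contain \<open>j\<close>.\<close>

lemma not_in_parabolic_trans:
  assumes "\<not> in_parabolic I \<tau> i j" "\<not> in_parabolic I \<tau> j k"
  shows "\<not> in_parabolic I \<tau> i k"
proof
  assume "in_parabolic I \<tau> i k"
  moreover have "j < i" "k < j"
    using assms by (auto simp: in_parabolic_def)
  ultimately have "same_block I \<tau> i k"
    by (auto simp: in_parabolic_def)
  then have "same_block I \<tau> i j"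
    by (rule same_block_subinterval) (use \<open>j < i\<close> \<open>k < j\<close> in auto)
  then show False using assms by (simp add: in_parabolic_def)
qed

text \<open>The witness is the immediate successor of \<open>i\<close>, which exists by
  finiteness.\<close>

lemma simple_root_from:
  fixes i j :: "'n::{finite,linorder}"
  assumes "i < j"
  obtains k where "(\<tau>, i, k) \<in> simple_roots" "k \<le> j"
proof
  have fin: "finite {i<..}" "{i<..} \<noteq> {}" using assms by auto
  have "\<not> k < Min {i<..}" if "i < k" for k
    using that by (simp add: not_less Min_le)
  then show "(\<tau>, i, Min {i<..}) \<in> simple_roots"
    using Min_in[OF fin] by (auto simp: simple_roots_def)
  show "Min {i<..} \<le> j"
    using fin assms by (simp add: Min_le)
qed

text \<open>Distinct indices always have a simple root between them, so for \<open>I = {}\<close>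
  the blocks are singletons. Hence \<open>lie_nilradical {}\<close> is the strictly upper triangular
  algebra \<uu>.\<close>

lemma same_block_empty [simp]: "same_block {} \<tau> i j \<longleftrightarrow> i = (j :: 'n::{finite,linorder})"
proof -
  have "\<not> same_block {} \<tau> a b" if "a < b" for a b :: 'n
    using that by (auto simp: same_block_def elim!: simple_root_from[of a b \<tau>] intro!: exI)
  then show ?thesis
    by (metis linorder_less_linear same_block_commute same_block_refl)
qed

section \<open>Matrices supported on a preorder\<close>

lemma matrix_inv_right: "invertible A \<Longrightarrow> A ** matrix_inv A = mat 1"
  and matrix_inv_left: "invertible A \<Longrightarrow> matrix_inv A ** A = mat 1"
  unfolding invertible_def matrix_inv_def by (metis (mono_tags, lifting) someI_ex)+

lemma matrix_vector_mult_basis_gen: "(A :: 'k::field^'n^'m) *v axis j 1 = column j A"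
  by (simp add: vec_eq_iff matrix_vector_mult_def column_def axis_def if_distrib cong: if_cong)

lemma matrix_inv_unique:
  assumes "(A :: 'k::field^'n^'n) ** B = mat 1"
  shows "matrix_inv A = B"
proof -
  have "invertible A"
    using assms matrix_left_right_inverse[of A B] by (auto simp: invertible_def)
  then have "matrix_inv A = matrix_inv A ** (A ** B)"
    using assms by simp
  also have "\<dots> = B"
    using \<open>invertible A\<close> by (simp add: matrix_mul_assoc matrix_inv_left)
  finally show ?thesis .
qed

(* The vectors supported on {i. R i j} form a finite-dimensional subspace which A maps injectively,
   hence onto itself; the j-th column of the inverse is the preimage of the j-th basis vector. *)
lemma supported_matrix_inv:
  fixes A :: "'k::field^'n^'n"
  assumes "invertible A" and supp: "\<And>i j. A $ i $ j \<noteq> 0 \<Longrightarrow> R i j"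
    and refl: "\<And>i. R i i" and trans: "\<And>i j k. R i j \<Longrightarrow> R j k \<Longrightarrow> R i k"
    and "matrix_inv A $ i $ j \<noteq> 0"
  shows "R i j"
proof -
  define V where "V = {v :: 'k^'n. \<forall>i. v $ i \<noteq> 0 \<longrightarrow> R i j}"
  have sub: "vec.subspace V"
    unfolding V_def vec.subspace_def by (auto) (metis add.right_neutral)
  have "(*v) A ` V \<subseteq> V"
  proof clarsimp
    fix v assume v: "v \<in> V"
    show "A *v v \<in> V"
      unfolding V_def
    proof clarify
      fix i assume "(A *v v) $ i \<noteq> 0"
      then obtain m where "A $ i $ m * v $ m \<noteq> 0"
        unfolding matrix_vector_mult_def by (auto elim: sum.not_neutral_contains_not_neutral)
      then show "R i j"
        using supp[of i m] v trans[of i m j] by (auto simp: V_def)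
    qed
  qed
  moreover have inj: "inj ((*v) A)"
    using \<open>invertible A\<close> matrix_left_invertible_injective unfolding invertible_def by blast
  moreover have "vec.dim ((*v) A ` V) = vec.dim V"
    by (rule vec.dim_image_eq[OF matrix_vector_mul_linear_gen]) (use inj inj_on_subset in blast)
  ultimately have "(*v) A ` V = V"
    by (intro vec.subspace_dim_equal vec.subspace_image sub) auto
  moreover have "axis j 1 \<in> V"
    by (auto simp: V_def axis_def refl)
  ultimately obtain v where v: "v \<in> V" "A *v v = axis j 1"
    by (metis imageE)
  have "v = matrix_inv A *v (A *v v)"
    using \<open>invertible A\<close> by (simp add: matrix_vector_mul_assoc matrix_inv_left)
  also have "\<dots> = column j (matrix_inv A)"
    unfolding v(2) by (rule matrix_vector_mult_basis_gen)
  finally have "v $ i = matrix_inv A $ i $ j"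
    by (simp add: column_def)
  then show "R i j"
    using v(1) assms(5) by (simp add: V_def)
qed

lemma matrix_mult_nonzero_entry:
  fixes A :: "'k::field^'m^'n" and B :: "'k^'p^'m"
  assumes "(A ** B) $ i $ j \<noteq> 0"
  obtains k where "A $ i $ k \<noteq> 0" "B $ k $ j \<noteq> 0"
proof -
  obtain k where "A $ i $ k * B $ k $ j \<noteq> 0"
    using assms unfolding matrix_matrix_mult_def
    by (auto elim: sum.not_neutral_contains_not_neutral)
  then show ?thesis using that[of k] by auto
qed

section \<open>The group and its parabolic subgroups\<close>

lemma gmult_assoc: "gmult (gmult a b) c = gmult a (gmult b c)"
  by (simp add: gmult_def matrix_mul_assoc)

lemma gmult_one [simp]: "gmult (\<lambda>\<tau>. mat 1) a = a" "gmult a (\<lambda>\<tau>. mat 1) = a"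
  by (simp_all add: gmult_def)

lemma gmult_ginv [simp]:
  assumes "g \<in> GL"
  shows "gmult g (ginv g) = (\<lambda>\<tau>. mat 1)" "gmult (ginv g) g = (\<lambda>\<tau>. mat 1)"
  using assms by (auto simp: GL_def gmult_def ginv_def matrix_inv_left matrix_inv_right)

lemma gmult_ginv_cancel [simp]:
  assumes "g \<in> GL"
  shows "gmult g (gmult (ginv g) a) = a" "gmult (ginv g) (gmult g a) = a"
  using assms by (simp_all flip: gmult_assoc)

lemma one_in_GL [simp]: "(\<lambda>\<tau>. mat 1) \<in> GL"
  unfolding GL_def invertible_def by (intro CollectI allI exI[of _ "mat 1"]) simp

lemma gmult_in_GL [intro]: "g \<in> GL \<Longrightarrow> h \<in> GL \<Longrightarrow> gmult g h \<in> GL"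
  by (simp add: GL_def gmult_def invertible_mult)

lemma invertible_matrix_inv: "invertible A \<Longrightarrow> invertible (matrix_inv A)"
  using matrix_inv_left matrix_inv_right unfolding invertible_def by blast

lemma ginv_in_GL [intro]: "g \<in> GL \<Longrightarrow> ginv g \<in> GL"
  by (simp add: GL_def ginv_def invertible_matrix_inv)

lemma ginv_eqI: "gmult g h = (\<lambda>\<tau>. mat 1) \<Longrightarrow> ginv g = h"
  by (auto simp: gmult_def ginv_def fun_eq_iff matrix_inv_unique)

lemma ginv_gmult: "g \<in> GL \<Longrightarrow> h \<in> GL \<Longrightarrow> ginv (gmult g h) = gmult (ginv h) (ginv g)"
  by (rule ginv_eqI) (simp add: gmult_assoc)

lemma ginv_ginv [simp]: "g \<in> GL \<Longrightarrow> ginv (ginv g) = g"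
  by (rule ginv_eqI) simp

lemma ginv_one [simp]: "ginv (\<lambda>\<tau>. mat 1) = (\<lambda>\<tau>. mat 1)"
  by (rule ginv_eqI) simp

section \<open>The adjoint action on the Lie algebras\<close>

lemma Ad_one [simp]: "Ad (\<lambda>\<tau>. mat 1) x = x"
  by (simp add: Ad_def)

lemma Ad_gmult: "g \<in> GL \<Longrightarrow> h \<in> GL \<Longrightarrow> Ad (gmult g h) x = Ad g (Ad h x)"
  by (simp add: Ad_def ginv_gmult gmult_assoc)

lemma Ad_Ad_ginv [simp]:
  assumes "g \<in> GL"
  shows "Ad g (Ad (ginv g) x) = x" "Ad (ginv g) (Ad g x) = x"
  using assms by (simp_all flip: Ad_gmult add: ginv_in_GL)

lemma lie_parabolic_alt: "x \<in> lie_parabolic I \<longleftrightarrow> (\<forall>\<tau> i j. x \<tau> $ i $ j \<noteq> 0 \<longrightarrow> in_parabolic I \<tau> i j)"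
  by (simp add: lie_parabolic_def in_parabolic_def)

lemma lie_parabolic_gmult:
  "x \<in> lie_parabolic I \<Longrightarrow> y \<in> lie_parabolic I \<Longrightarrow> gmult x y \<in> lie_parabolic I"
  unfolding lie_parabolic_alt gmult_def by (meson in_parabolic_trans matrix_mult_nonzero_entry)

lemma parabolic_subset_GL: "parabolic I \<subseteq> GL"
  by (simp add: parabolic_def)

lemma one_in_parabolic [simp]: "(\<lambda>\<tau>. mat 1) \<in> parabolic I"
proof -
  have "(\<lambda>\<tau>. mat 1) \<in> lie_parabolic I"
    by (simp add: lie_parabolic_alt mat_def)
  then show ?thesis by (simp add: parabolic_def)
qed

lemma ginv_in_parabolic:
  assumes "q \<in> parabolic I"
  shows "ginv q \<in> parabolic I"
proof -
  have "in_parabolic I \<tau> i j" if "matrix_inv (q \<tau>) $ i $ j \<noteq> 0" for \<tau> i j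
    by (rule supported_matrix_inv[where R = "in_parabolic I \<tau>", OF _ _ _ _ that])
      (use assms in \<open>auto simp: parabolic_def GL_def lie_parabolic_alt intro: in_parabolic_trans\<close>)
  then have "ginv q \<in> lie_parabolic I"
    by (simp add: lie_parabolic_alt ginv_def)
  then show ?thesis
    using assms by (auto simp: parabolic_def)
qed

lemma Ad_parabolic:
  "q \<in> parabolic I \<Longrightarrow> y \<in> lie_parabolic I \<Longrightarrow> Ad q y \<in> lie_parabolic I"
  using ginv_in_parabolic[of q I] by (auto simp: Ad_def parabolic_def intro: lie_parabolic_gmult)

text \<open>Upper triangular conjugation moves a position \<open>(k, l)\<close> only up and to the
  right. The new interval contains the old one, so it cannot fit into a block either.\<close>

lemma Ad_borel_nilradical:
  assumes "b \<in> borel_subgroup" "x \<in> lie_nilradical J"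
  shows "Ad b x \<in> lie_nilradical J"
  unfolding lie_nilradical_def
proof (intro CollectI allI impI)
  fix \<tau> i j assume "Ad b x \<tau> $ i $ j \<noteq> 0"
  then obtain k l where kl: "b \<tau> $ i $ k \<noteq> 0" "x \<tau> $ k $ l \<noteq> 0" "ginv b \<tau> $ l $ j \<noteq> 0"
    unfolding Ad_def gmult_def by (elim matrix_mult_nonzero_entry)
  then have "i \<le> k" "l \<le> j"
    using assms(1) ginv_in_parabolic[OF assms(1)] by (fastforce simp: parabolic_def lie_parabolic_def)+
  moreover have "k < l" "\<not> same_block J \<tau> k l"
    using assms(2) kl by (auto simp: lie_nilradical_def)
  ultimately show "i < j \<and> \<not> same_block J \<tau> i j"
    using same_block_subinterval[of J \<tau> i j k l] by auto
qed

lemma lcoset_eqD: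
  assumes "lcoset g (parabolic I) = lcoset g' (parabolic I)"
  obtains q where "q \<in> parabolic I" "g' = gmult g q"
proof -
  have "gmult g' (\<lambda>\<tau>. mat 1) \<in> lcoset g' (parabolic I)"
    unfolding lcoset_def by (rule imageI) (rule one_in_parabolic)
  then show ?thesis using that unfolding assms[symmetric] by (auto simp: lcoset_def)
qed

text \<open>Two representatives of a coset of B differ by an element of B, which stabilizes the
  nilradical. The condition is therefore one on points of G/B.\<close>

lemma nilradical_lcoset:
  assumes "g \<in> GL" "lcoset g borel_subgroup = lcoset g' borel_subgroup"
    and "Ad (ginv g) \<nu> \<in> lie_nilradical J"
  shows "Ad (ginv g') \<nu> \<in> lie_nilradical J"
proof -
  obtain b where b: "b \<in> borel_subgroup" "g' = gmult g b"
    using assms(2) by (rule lcoset_eqD)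
  then have "b \<in> GL" using parabolic_subset_GL by blast
  then have "Ad (ginv g') \<nu> = Ad (ginv b) (Ad (ginv g) \<nu>)"
    using assms(1) b by (simp add: ginv_gmult Ad_gmult ginv_in_GL)
  then show ?thesis
    using Ad_borel_nilradical[OF ginv_in_parabolic[OF b(1)] assms(3)] by simp
qed

section \<open>The cell of a Weyl group element\<close>

abbreviation weyl_inv :: "('s, 'n) weyl \<Rightarrow> ('s, 'n) weyl" where
  "weyl_inv w \<equiv> \<lambda>\<tau>. inv_into UNIV (w \<tau>)"

lemma weyl_inv_simps [simp]:
  assumes "w \<in> weyl_group"
  shows "w \<tau> (weyl_inv w \<tau> i) = i" "weyl_inv w \<tau> (w \<tau> i) = i"
  using assms by (simp_all add: weyl_group_def bij_is_surj bij_is_inj surj_f_inv_f)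

lemma weyl_lift_gmult:
  fixes x :: "('s, 'k::field, 'n::finite) mats"
  assumes "w \<in> weyl_group"
  shows "gmult (weyl_lift w) x \<tau> $ i $ j = x \<tau> $ weyl_inv w \<tau> i $ j"
proof -
  have "i = w \<tau> k \<longleftrightarrow> k = weyl_inv w \<tau> i" for k
    using weyl_inv_simps[OF assms] by metis
  then show ?thesis
    by (simp add: gmult_def weyl_lift_def matrix_matrix_mult_def of_bool_def if_distrib[of "\<lambda>c. c * _"] cong: if_cong)
qed

lemma gmult_weyl_lift:
  fixes x :: "('s, 'k::field, 'n::finite) mats"
  shows "gmult x (weyl_lift v) \<tau> $ i $ j = x \<tau> $ i $ v \<tau> j"
  by (simp add: gmult_def weyl_lift_def matrix_matrix_mult_def of_bool_def if_distrib[of "\<lambda>c. _ * c"] cong: if_cong)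

lemma gmult_weyl_lift_inv:
  assumes "w \<in> weyl_group"
  shows "gmult (weyl_lift w) (weyl_lift (weyl_inv w)) = (\<lambda>\<tau>. mat 1)"
proof (intro ext, simp only: vec_eq_iff, intro allI)
  fix \<tau> i j
  have "w \<tau> (weyl_inv w \<tau> j) = j" by (simp add: assms)
  then show "gmult (weyl_lift w) (weyl_lift (weyl_inv w)) \<tau> $ i $ j = mat 1 $ i $ j"
    by (simp add: gmult_weyl_lift mat_def) (simp add: weyl_lift_def)
qed

lemma weyl_lift_in_GL:
  assumes "w \<in> weyl_group"
  shows "weyl_lift w \<in> GL"
proof -
  have "weyl_lift w \<tau> ** weyl_lift (weyl_inv w) \<tau> = mat 1" for \<tau>
    using fun_cong[OF gmult_weyl_lift_inv[OF assms], of \<tau>] by (simp add: gmult_def)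
  then show ?thesis
    using matrix_left_right_inverse unfolding GL_def invertible_def by blast
qed

text \<open>Permutation matrices permute the root spaces: the entry at a root \<alpha> comes from
  the entry of \<open>x\<close> at the root obtained by applying the inverse of \<open>w\<close> to
  \<alpha>.\<close>

lemma Ad_weyl_lift:
  fixes x :: "('s, 'k::field, 'n::finite) mats"
  assumes "w \<in> weyl_group"
  shows "Ad (weyl_lift w) x \<tau> $ i $ j = x \<tau> $ weyl_inv w \<tau> i $ weyl_inv w \<tau> j"
  using assms by (simp add: Ad_def ginv_eqI[OF gmult_weyl_lift_inv] gmult_weyl_lift weyl_lift_gmult)

lemma steinberg_cell_subset_locus_iff:
  assumes w: "w \<in> weyl_group"
  shows "(steinberg_cell I w :: ('s, 'k::field, 'n::{finite,linorder}) flag_point set)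
           \<subseteq> steinberg_nilradical_locus I J \<longleftrightarrow>
    (\<forall>\<tau> i j. i < j \<longrightarrow> same_block J \<tau> i j \<longrightarrow> \<not> in_parabolic I \<tau> (weyl_inv w \<tau> i) (weyl_inv w \<tau> j))"
    (is "?L \<longleftrightarrow> ?R")
proof
  assume ?R
  show ?L
  proof
    fix x :: "('s, 'k, 'n) flag_point"
    assume "x \<in> steinberg_cell I w"
    then obtain \<nu> g1 g2 where x: "x = (\<nu>, lcoset g1 borel_subgroup, lcoset g2 (parabolic I))"
      and g: "g1 \<in> GL" "g2 \<in> GL" and u: "Ad (ginv g1) \<nu> \<in> lie_nilradical {}"
      and p: "Ad (ginv g2) \<nu> \<in> lie_parabolic I" and "gmult (ginv g1) g2 \<in> double_coset I w"
      unfolding steinberg_cell_def by blast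
    then obtain b q where bq: "b \<in> borel_subgroup" "q \<in> parabolic I"
      and eq: "gmult (ginv g1) g2 = gmult (gmult b (weyl_lift w)) q"
      unfolding double_coset_def by blast
    have GL: "b \<in> GL" "q \<in> GL" "weyl_lift w \<in> (GL :: ('s, 'k, 'n) mats set)"
      using bq parabolic_subset_GL weyl_lift_in_GL[OF w] by blast+
    \<comment> \<open>\<open>q\<close> is absorbed into \<pp>; what remains is to pass between
      \<open>Ad (weyl_lift w) y\<close> and its conjugate by \<open>b\<close>, which respects both
      nilradicals.\<close>
    define y where "y = Ad q (Ad (ginv g2) \<nu>)"
    have y: "y \<in> lie_parabolic I"
      unfolding y_def by (rule Ad_parabolic[OF bq(2) p])
    have "Ad (ginv g1) \<nu> = Ad (gmult (ginv g1) g2) (Ad (ginv g2) \<nu>)"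
      using g by (simp add: Ad_gmult ginv_in_GL)
    also have "\<dots> = Ad b (Ad (weyl_lift w) y)"
      unfolding eq y_def using GL by (simp add: Ad_gmult gmult_in_GL)
    finally have xb: "Ad (ginv g1) \<nu> = Ad b (Ad (weyl_lift w) y)" .
    have "Ad (weyl_lift w) y = Ad (ginv b) (Ad (ginv g1) \<nu>)"
      unfolding xb using GL by simp
    then have "Ad (weyl_lift w) y \<in> lie_nilradical {}"
      using Ad_borel_nilradical[OF ginv_in_parabolic[OF bq(1)] u] by simp
    \<comment> \<open>A nonzero entry sits at some \<open>i < j\<close> whose preimage under
      \<open>w\<close> is a position of \<pp>, and \<open>?R\<close> keeps such positions out of the
      blocks of \<open>J\<close>.\<close>
    then have "Ad (weyl_lift w) y \<in> lie_nilradical J"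
      using y \<open>?R\<close> unfolding lie_nilradical_def lie_parabolic_alt
      by (simp add: Ad_weyl_lift[OF w]) blast
    then have "Ad (ginv g1) \<nu> \<in> lie_nilradical J"
      unfolding xb by (rule Ad_borel_nilradical[OF bq(1)])
    then show "x \<in> steinberg_nilradical_locus I J"
      unfolding steinberg_nilradical_locus_def using x g u p by blast
  qed
next
  assume ?L
  show ?R
  proof (intro allI impI notI)
    fix \<tau> i j
    assume ij: "i < j" "same_block J \<tau> i j" and par: "in_parabolic I \<tau> (weyl_inv w \<tau> i) (weyl_inv w \<tau> j)"
    \<comment> \<open>The matrix unit at \<open>(i, j)\<close> lies in \<uu> and in Ad(w)\<pp> but
      not in the nilradical for \<open>J\<close>. With \<open>g1 = 1\<close> and \<open>g2\<close>
      the lift of \<open>w\<close> it gives a point of the cell outside the locus.\<close>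
    define \<nu> :: "('s, 'k, 'n) mats"
      where "\<nu> = (\<lambda>\<sigma>. \<chi> a b. of_bool (\<sigma> = \<tau> \<and> a = i \<and> b = j))"
    define e :: "('s, 'k, 'n) mats" where "e = (\<lambda>\<tau>. mat 1)"
    have e [simp]: "e \<in> GL" "ginv e = e" "Ad e x = x" "gmult e g = g" "gmult g e = g"
        "e \<in> parabolic I'" for x g I'
      by (simp_all add: e_def)
    let ?w = "weyl_lift w :: ('s, 'k, 'n) mats"
    \<comment> \<open>Entries are known for conjugation by \<open>?w\<close> only, so \<nu> is
      written as such a conjugate of a reindexed matrix, and the two conjugations cancel.\<close>
    have "Ad (ginv ?w) \<nu> = Ad (ginv ?w) (Ad ?w (\<lambda>\<sigma>. \<chi> a b. \<nu> \<sigma> $ w \<sigma> a $ w \<sigma> b))"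
      by (rule arg_cong[where f = "Ad (ginv ?w)"]) (simp add: fun_eq_iff vec_eq_iff Ad_weyl_lift[OF w] w)
    also have "\<dots> = (\<lambda>\<sigma>. \<chi> a b. \<nu> \<sigma> $ w \<sigma> a $ w \<sigma> b)"
      by (simp add: weyl_lift_in_GL[OF w])
    also have "\<dots> \<in> lie_parabolic I"
      unfolding lie_parabolic_alt \<nu>_def using par w by auto
    finally have "Ad (ginv ?w) \<nu> \<in> lie_parabolic I" .
    moreover have "Ad (ginv e) \<nu> \<in> lie_nilradical {}"
      using ij by (auto simp: lie_nilradical_def \<nu>_def)
    moreover have "gmult (ginv e) ?w \<in> double_coset I w"
      unfolding double_coset_def by (auto intro!: exI[of _ e])
    ultimately have "(\<nu>, lcoset e borel_subgroup, lcoset ?w (parabolic I)) \<in> steinberg_cell I w"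
      unfolding steinberg_cell_def using e(1) weyl_lift_in_GL[OF w] by blast
    then have "(\<nu>, lcoset e borel_subgroup, lcoset ?w (parabolic I)) \<in> steinberg_nilradical_locus I J"
      using \<open>?L\<close> by blast
    \<comment> \<open>Membership in the locus yields some representative of the coset of
      \<open>e\<close>, not \<open>e\<close> itself.\<close>
    then obtain g1 where "g1 \<in> GL" "lcoset g1 borel_subgroup = lcoset e borel_subgroup"
      "Ad (ginv g1) \<nu> \<in> lie_nilradical J"
      unfolding steinberg_nilradical_locus_def by auto
    then have "Ad (ginv e) \<nu> \<in> lie_nilradical J"
      by (rule nilradical_lcoset)
    then have "\<not> same_block J \<tau> i j"
      by (auto simp: lie_nilradical_def \<nu>_def)
    then show False using ij by simp
  qed
qed

section \<open>Closedness of the nilradical locus\<close>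

lemma regular_sum:
  assumes "\<And>i. i \<in> A \<Longrightarrow> f i \<in> regular_functions"
  shows "(\<lambda>x. \<Sum>i\<in>A. f i x) \<in> regular_functions"
  using assms
proof (induction A rule: infinite_finite_induct)
  case (insert a A)
  then show ?case using regular_functions.add[of "f a" "\<lambda>x. \<Sum>i\<in>A. f i x"] by simp
qed (use regular_functions.const[of 0] in simp_all)

lemma regular_prod:
  assumes "\<And>i. i \<in> A \<Longrightarrow> f i \<in> regular_functions"
  shows "(\<lambda>x. \<Prod>i\<in>A. f i x) \<in> regular_functions"
  using assms
proof (induction A rule: infinite_finite_induct)
  case (insert a A)
  then show ?case using regular_functions.mult[of "f a" "\<lambda>x. \<Prod>i\<in>A. f i x"] by simp
qed (use regular_functions.const[of 1] in simp_all)

lemma regular_det: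
  fixes M :: "_ \<Rightarrow> 'l::field alg_closure^'m^'m"
  assumes "\<And>i j. (\<lambda>x. M x $ i $ j) \<in> regular_functions"
  shows "(\<lambda>x. det (M x)) \<in> regular_functions"
  unfolding det_def
proof (intro regular_sum regular_functions.mult regular_prod assms)
  fix p :: "'m \<Rightarrow> 'm"
  show "(\<lambda>_. of_int (sign p)) \<in> regular_functions"
    using regular_functions.const[of "of_int (sign p)"] by simp
qed

text \<open>Cramer's rule for the system with right-hand side the \<open>j\<close>-th basis vector.
  It exhibits the entries of the inverse as polynomials in the entries of \<open>A\<close> and the
  inverse determinant.\<close>

lemma matrix_inv_entry:
  fixes A :: "'k::field^'n^'n"
  assumes "invertible A"
  shows "matrix_inv A $ i $ j =
    inverse (det A) * det (\<chi> k l. if l = i then of_bool (k = j) else A $ k $ l)"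
proof -
  have "A *v (matrix_inv A *v axis j 1) = axis j 1"
    using assms by (simp add: matrix_vector_mul_assoc matrix_inv_right)
  then have col: "(A *v (matrix_inv A *v axis j 1)) $ k = of_bool (k = j)" for k
    by (simp add: axis_def)
  have "det (\<chi> k l. if l = i then of_bool (k = j) else A $ k $ l)
      = (matrix_inv A *v axis j 1) $ i * det A"
    using cramer_lemma[where A = A and x = "matrix_inv A *v axis j 1" and k = i]
    unfolding col .
  also have "(matrix_inv A *v axis j 1) $ i = matrix_inv A $ i $ j"
    by (simp add: matrix_vector_mult_basis_gen column_def)
  finally show ?thesis
    using assms by (simp add: invertible_det_nz)
qed

lemma regular_Ad_ginv_entry:
  obtains f :: "('s, 'l::field alg_closure, 'n::finite) triple \<Rightarrow> 'l alg_closure" where "f \<in> regular_functions"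
    and "\<And>\<nu> g h. g \<in> GL \<Longrightarrow> f (\<nu>, g, h) = Ad (ginv g) \<nu> \<tau> $ i $ j"
proof
  let ?c = "\<lambda>k. \<lambda>(\<nu> :: ('s, 'l alg_closure, 'n) mats, g :: ('s, 'l alg_closure, 'n) mats,
      h :: ('s, 'l alg_closure, 'n) mats). inverse (det (g \<tau>)) *
      det (\<chi> a b. if b = i then of_bool (a = k) else g \<tau> $ a $ b)"
  let ?f = "\<lambda>(\<nu>, g, h). \<Sum>l\<in>UNIV. (\<Sum>k\<in>UNIV. ?c k (\<nu>, g, h) * \<nu> \<tau> $ k $ l) * g \<tau> $ l $ j"
  have "(\<lambda>(\<nu>, g, h). det (\<chi> a b. if b = i then of_bool (a = k) else g \<tau> $ a $ b))
      \<in> regular_functions" for k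
    unfolding split_def
  proof (rule regular_det)
    fix a b
    show "(\<lambda>x. (\<chi> a b. if b = i then of_bool (a = k) else fst (snd x) \<tau> $ a $ b) $ a $ b)
      \<in> regular_functions"
      using regular_functions.const[of "of_bool (a = k)"] regular_functions.entry_g[of \<tau> a b]
      by (cases "b = i"; cases "a = k") (simp_all add: split_def)
  qed
  then have "?c k \<in> regular_functions" for k
    using regular_functions.mult[OF regular_functions.inv_det_g[of \<tau>]] unfolding split_def by fast
  then have c: "(\<lambda>x. ?c k (fst x, fst (snd x), snd (snd x))) \<in> regular_functions" for k
    unfolding split_def fst_conv snd_conv .
  have "(\<lambda>x. fst x \<tau> $ k $ l) \<in> regular_functions" "(\<lambda>x. fst (snd x) \<tau> $ k $ l) \<in> regular_functions" for k l
    using regular_functions.entry_nu[of \<tau> k l] regular_functions.entry_g[of \<tau> k l] by (simp_all add: split_def)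
  then have "(\<lambda>x. \<Sum>l\<in>UNIV. (\<Sum>k\<in>UNIV. ?c k (fst x, fst (snd x), snd (snd x)) * fst x \<tau> $ k $ l)
      * fst (snd x) \<tau> $ l $ j) \<in> regular_functions"
    by (intro regular_sum regular_functions.mult[OF regular_sum] regular_functions.mult[OF c])
  then show "?f \<in> regular_functions"
    unfolding split_def fst_conv snd_conv .
  show "?f (\<nu>, g, h) = Ad (ginv g) \<nu> \<tau> $ i $ j" if "g \<in> GL" for \<nu> g h
  proof -
    have "invertible (g \<tau>)" using that by (simp add: GL_def)
    moreover have "ginv (ginv g) = g" using that by simp
    ultimately show ?thesis
      by (simp add: Ad_def gmult_def matrix_matrix_mult_def ginv_def[of g] matrix_inv_entry)
  qed
qed

section \<open>Zariski topology on triples and on flag points\<close>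

lemma topspace_zariski_triples:
  "topspace (zariski_triples :: ('s, 'l::field alg_closure, 'n::finite) triple topology)
     = UNIV \<times> GL \<times> GL"
proof -
  let ?one = "\<lambda>_ :: ('s, 'l alg_closure, 'n) triple. 1 :: 'l alg_closure"
  \<comment> \<open>The nonvanishing set of the constant 1 is the whole space of triples, which is
    thus a basic open set.\<close>
  have "?one \<in> regular_functions"
    using regular_functions.const[of 1] by simp
  then have "{x \<in> UNIV \<times> GL \<times> GL. ?one x \<noteq> 0} \<subseteq> topspace zariski_triples"
    unfolding zariski_triples_def topology_generated_by_topspace by blast
  then show ?thesis
    by (auto simp: zariski_triples_def topology_generated_by_topspace)
qed

text \<open>Outside the set some forbidden entry of \<open>Ad (ginv g) \<nu>\<close> is nonzero.
  That entry is a regular function, so its nonvanishing is an open neighbourhood within the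
  complement.\<close>

lemma closedin_zariski_nilradical:
  "closedin zariski_triples
     {(\<nu> :: ('s, 'l::field alg_closure, 'n::{finite,linorder}) mats, g, h).
        g \<in> GL \<and> h \<in> GL \<and> Ad (ginv g) \<nu> \<in> lie_nilradical J}" (is "closedin _ ?C")
  unfolding closedin_def
proof
  show "?C \<subseteq> topspace zariski_triples"
    by (auto simp: topspace_zariski_triples)
  show "openin zariski_triples (topspace zariski_triples - ?C)"
  proof (subst openin_subopen, intro ballI)
    fix x assume "x \<in> topspace zariski_triples - ?C"
    then obtain \<nu> g h where x: "x = (\<nu>, g, h)" "g \<in> GL" "h \<in> GL" "Ad (ginv g) \<nu> \<notin> lie_nilradical J"
      by (auto simp: topspace_zariski_triples)
    then obtain \<tau> i j where ij: "Ad (ginv g) \<nu> \<tau> $ i $ j \<noteq> 0" "\<not> (i < j \<and> \<not> same_block J \<tau> i j)"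
      by (auto simp: lie_nilradical_def)
    obtain f :: "('s, 'l alg_closure, 'n) triple \<Rightarrow> 'l alg_closure" where f: "f \<in> regular_functions"
      "\<And>\<nu> g h. g \<in> GL \<Longrightarrow> f (\<nu>, g, h) = Ad (ginv g) \<nu> \<tau> $ i $ j"
      using regular_Ad_ginv_entry[of \<tau> i j] by metis
    let ?U = "{x \<in> UNIV \<times> GL \<times> GL. f x \<noteq> 0}"
    have "openin zariski_triples ?U"
      unfolding zariski_triples_def openin_topology_generated_by_iff
      using f(1) by (intro generate_topology_on.Basis) blast
    moreover have "x \<in> ?U"
      using x ij f(2) by auto
    moreover have "?U \<subseteq> topspace zariski_triples - ?C"
      using ij f(2) by (auto simp: topspace_zariski_triples lie_nilradical_def)
    ultimately show "\<exists>U. openin zariski_triples U \<and> x \<in> U \<and> U \<subseteq> topspace zariski_triples - ?C"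
      by blast
  qed
qed

lemma topspace_zariski_flag:
  "topspace (zariski_flag I :: ('s, 'l::field alg_closure, 'n::{finite,linorder}) flag_point topology)
     = flag_proj I ` (UNIV \<times> GL \<times> GL)"
  unfolding zariski_flag_def topspace_zariski_triples[symmetric]
  by (rule quotient_imp_surjective_map[OF quotient_map_quotient_topology, symmetric])

text \<open>A closed set of triples descends along the quotient map when it is a union of fibres,
  which \<open>nilradical_lcoset\<close> provides.\<close>

lemma closedin_steinberg_nilradical_locus:
  "closedin (subtopology (zariski_flag I) (steinberg I))
     (steinberg_nilradical_locus I J :: ('s, 'l::field alg_closure, 'n::{finite,linorder}) flag_point set)"
proof -
  \<comment> \<open>Only the condition for \<open>J\<close> is imposed here; the defining conditions
    of \<open>steinberg I\<close> return through the subspace topology.\<close>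
  let ?C = "{(\<nu> :: ('s, 'l alg_closure, 'n) mats, g, h).
        g \<in> GL \<and> h \<in> GL \<and> Ad (ginv g) \<nu> \<in> lie_nilradical J}"
  have "x \<in> ?C" if x: "x \<in> UNIV \<times> GL \<times> GL" "flag_proj I x \<in> flag_proj I ` ?C" for x
    using x by (auto simp: flag_proj_def intro: nilradical_lcoset[OF _ sym])
  moreover have "?C \<subseteq> UNIV \<times> GL \<times> GL" by auto
  ultimately have saturated: "{x \<in> UNIV \<times> GL \<times> GL. flag_proj I x \<in> flag_proj I ` ?C} = ?C"
    by blast
  have "flag_proj I ` ?C \<subseteq> topspace (zariski_flag I)"
    unfolding topspace_zariski_flag by (intro image_mono) auto
  moreover have "closedin zariski_triples {x \<in> topspace zariski_triples. flag_proj I x \<in> flag_proj I ` ?C}"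
    unfolding topspace_zariski_triples saturated by (rule closedin_zariski_nilradical)
  ultimately have "closedin (zariski_flag I) (flag_proj I ` ?C)"
    using quotient_map_quotient_topology[of zariski_triples "flag_proj I"]
    unfolding zariski_flag_def quotient_map_closedin by blast
  moreover have "steinberg_nilradical_locus I J = flag_proj I ` ?C \<inter> steinberg I"
  proof
    show "steinberg_nilradical_locus I J \<subseteq> flag_proj I ` ?C \<inter> steinberg I"
      by (fastforce simp: steinberg_nilradical_locus_def steinberg_def flag_proj_def image_iff)
    show "flag_proj I ` ?C \<inter> steinberg I \<subseteq> steinberg_nilradical_locus I J"
    proof
      fix x assume x: "x \<in> flag_proj I ` ?C \<inter> steinberg I"
      then obtain \<nu> g1 g2 where g: "x = (\<nu>, lcoset g1 borel_subgroup, lcoset g2 (parabolic I))"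
        "g1 \<in> GL" "g2 \<in> GL" "Ad (ginv g1) \<nu> \<in> lie_nilradical {}" "Ad (ginv g2) \<nu> \<in> lie_parabolic I"
        unfolding steinberg_def by blast
      moreover have "Ad (ginv g1) \<nu> \<in> lie_nilradical J"
        using x g(1) by (auto simp: flag_proj_def intro: nilradical_lcoset[OF _ sym])
      ultimately show "x \<in> steinberg_nilradical_locus I J"
        unfolding steinberg_nilradical_locus_def by blast
    qed
  qed
  ultimately show ?thesis
    unfolding closedin_subtopology by blast
qed

lemma steinberg_component_subset_locus_iff:
  "(steinberg_component I w :: ('s, 'l::field alg_closure, 'n::{finite,linorder}) flag_point set)
       \<subseteq> steinberg_nilradical_locus I J \<longleftrightarrow>
   (steinberg_cell I w :: ('s, 'l alg_closure, 'n) flag_point set) \<subseteq> steinberg_nilradical_locus I J"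
proof -
  \<comment> \<open>\<open>closure_of\<close> stays inside the topspace, so it contains the cell
    only once the cell is known to lie there.\<close>
  have "(steinberg_cell I w :: ('s, 'l alg_closure, 'n) flag_point set) \<subseteq> steinberg I"
    by (auto simp: steinberg_cell_def steinberg_def)
  moreover have "(steinberg I :: ('s, 'l alg_closure, 'n) flag_point set) \<subseteq> topspace (zariski_flag I)"
    by (fastforce simp: steinberg_def topspace_zariski_flag flag_proj_def image_iff)
  ultimately have "(steinberg_cell I w :: ('s, 'l alg_closure, 'n) flag_point set)
      \<subseteq> steinberg_component I w"
    unfolding steinberg_component_def by (intro closure_of_subset) auto
  then show ?thesis
    unfolding steinberg_component_def
    using closure_of_minimal[OF _ closedin_steinberg_nilradical_locus] by blast
qed

section \<open>Length and the longest element\<close>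

text \<open>The positive roots made negative by \<open>w\<close>. Their number is the length, which
  gives access to \<open>longest\<close>.\<close>

definition inversions :: "('s, 'n::linorder) weyl \<Rightarrow> ('s, 'n) root set" where
  "inversions w = {(\<tau>, i, j). i < j \<and> w \<tau> j < w \<tau> i}"

lemma id_in_weyl_group: "(\<lambda>\<tau>. id) \<in> weyl_group"
  by (simp add: weyl_group_def)

lemma weyl_mult_in_weyl_group [intro]:
  "v \<in> weyl_group \<Longrightarrow> w \<in> weyl_group \<Longrightarrow> weyl_mult v w \<in> weyl_group"
  by (auto simp: weyl_group_def weyl_mult_def intro: bij_comp)

lemma inversions_id: "inversions (\<lambda>\<tau>. id) = {}"
  by (auto simp: inversions_def)

lemma reflection_in_weyl_group [simp]: "reflection \<alpha> \<in> weyl_group"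
  by (cases \<alpha>) (auto simp: weyl_group_def reflection_def)

lemma reflection_reflection [simp]: "weyl_mult (reflection \<alpha>) (weyl_mult (reflection \<alpha>) w) = w"
  by (cases \<alpha>) (auto simp: weyl_mult_def reflection_def fun_eq_iff)

text \<open>Any third index compares in the same way with both of two adjacent indices, so swapping
  these reverses no other pair.\<close>

lemma transpose_adjacent_less_iff:
  fixes a b x y :: "'n::linorder"
  assumes "a < b" "\<not> (\<exists>k. a < k \<and> k < b)" "{x, y} \<noteq> {a, b}" "x \<noteq> y"
  shows "Transposition.transpose a b x < Transposition.transpose a b y \<longleftrightarrow> x < y"
  using assms unfolding Transposition.transpose_def
  by (auto; metis less_trans linorder_neqE insert_commute)

text \<open>Left multiplication by a simple reflection swaps two adjacent values; only the pair of
  positions holding them changes its order.\<close>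

lemma inversions_reflection:
  assumes w: "w \<in> weyl_group" and ab: "(\<tau>, a, b) \<in> simple_roots"
    and less: "weyl_inv w \<tau> a < weyl_inv w \<tau> b"
  shows "inversions (weyl_mult (reflection (\<tau>, a, b)) w)
      = insert (\<tau>, weyl_inv w \<tau> a, weyl_inv w \<tau> b) (inversions w)" (is "inversions ?v = insert ?\<alpha> _")
    and "(\<tau>, weyl_inv w \<tau> a, weyl_inv w \<tau> b) \<notin> inversions w"
proof -
  have adj: "a < b" "\<not> (\<exists>k. a < k \<and> k < b)"
    using ab by (auto simp: simple_roots_def)
  show "?\<alpha> \<notin> inversions w"
    using adj w by (auto simp: inversions_def)
  have "(\<sigma>, k, l) \<in> inversions ?v \<longleftrightarrow> (\<sigma>, k, l) \<in> insert ?\<alpha> (inversions w)" for \<sigma> k l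
  proof (cases "\<sigma> = \<tau>")
    case False
    then show ?thesis by (simp add: inversions_def weyl_mult_def reflection_def)
  next
    case True
    show ?thesis
    proof (cases "k < l \<and> (k, l) \<noteq> (weyl_inv w \<tau> a, weyl_inv w \<tau> b)")
      case kl: True
      then have "w \<tau> k \<noteq> w \<tau> l"
        using weyl_inv_simps(2)[OF w] by (metis less_irrefl)
      moreover have "{w \<tau> l, w \<tau> k} \<noteq> {a, b}"
        using kl less weyl_inv_simps(2)[OF w] by (metis doubleton_eq_iff less_asym)
      ultimately show ?thesis
        using kl \<open>\<sigma> = \<tau>\<close> adj
        by (auto simp: inversions_def weyl_mult_def reflection_def transpose_adjacent_less_iff)
    next
      case kl: False
      then show ?thesis
        using \<open>\<sigma> = \<tau>\<close> adj less w by (auto simp: inversions_def weyl_mult_def reflection_def)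
    qed
  qed
  then show "inversions ?v = insert ?\<alpha> (inversions w)" by auto
qed

lemma card_inversions_reflection:
  fixes w :: "('s::finite, 'n::{finite,linorder}) weyl"
  assumes "w \<in> weyl_group" "(\<tau>, a, b) \<in> simple_roots" "weyl_inv w \<tau> a < weyl_inv w \<tau> b"
  shows "card (inversions (weyl_mult (reflection (\<tau>, a, b)) w)) = Suc (card (inversions w))"
  using inversions_reflection[OF assms] by simp

text \<open>The ascending case applied to the reflected element: reflecting twice gives back
  \<open>w\<close>.\<close>

lemma card_inversions_reflection_descent:
  fixes w :: "('s::finite, 'n::{finite,linorder}) weyl"
  assumes w: "w \<in> weyl_group" and ab: "(\<tau>, a, b) \<in> simple_roots"
    and less: "weyl_inv w \<tau> b < weyl_inv w \<tau> a"
  shows "card (inversions w) = Suc (card (inversions (weyl_mult (reflection (\<tau>, a, b)) w)))"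
proof -
  let ?v = "weyl_mult (reflection (\<tau>, a, b)) w"
  have v: "?v \<in> weyl_group" using w by auto
  have "?v \<tau> (weyl_inv w \<tau> b) = a" "?v \<tau> (weyl_inv w \<tau> a) = b"
    using w by (simp_all add: weyl_mult_def reflection_def)
  then have "weyl_inv ?v \<tau> a = weyl_inv w \<tau> b" "weyl_inv ?v \<tau> b = weyl_inv w \<tau> a"
    using weyl_inv_simps(2)[OF v] by metis+
  then show ?thesis
    using card_inversions_reflection[OF v ab] less by simp
qed

section \<open>Words in simple reflections\<close>

definition weyl_word :: "('s, 'n) root list \<Rightarrow> ('s, 'n) weyl" where
  "weyl_word \<alpha>s = foldr weyl_mult (map reflection \<alpha>s) (\<lambda>\<tau>. id)"

lemma weyl_word_Nil: "weyl_word [] = (\<lambda>\<tau>. id)"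
  by (simp add: weyl_word_def)

lemma weyl_word_Cons: "weyl_word (\<alpha> # \<alpha>s) = weyl_mult (reflection \<alpha>) (weyl_word \<alpha>s)"
  by (simp add: weyl_word_def)

text \<open>Each letter changes the number of inversions by exactly one, up or down. This bounds the
  length from below.\<close>

lemma inversions_weyl_word_le:
  fixes \<alpha>s :: "('s::finite, 'n::{finite,linorder}) root list"
  assumes "set \<alpha>s \<subseteq> simple_roots"
  shows "weyl_word \<alpha>s \<in> weyl_group \<and> card (inversions (weyl_word \<alpha>s)) \<le> length \<alpha>s"
  using assms
proof (induction \<alpha>s)
  case Nil
  show ?case unfolding weyl_word_Nil inversions_id by (intro conjI id_in_weyl_group) simp
next
  case (Cons \<alpha> \<alpha>s)
  obtain \<tau> a b where \<alpha>: "\<alpha> = (\<tau>, a, b)" by (cases \<alpha>)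
  let ?v = "weyl_word \<alpha>s"
  have v: "?v \<in> weyl_group" and ab: "(\<tau>, a, b) \<in> simple_roots"
    using Cons \<alpha> by auto
  have "weyl_inv ?v \<tau> a \<noteq> weyl_inv ?v \<tau> b"
    using weyl_inv_simps(1)[OF v] ab by (metis (no_types, lifting) simple_roots_def case_prodD less_irrefl mem_Collect_eq)
  then have "card (inversions (weyl_mult (reflection \<alpha>) ?v)) \<le> Suc (card (inversions ?v))"
    using card_inversions_reflection[OF v ab] card_inversions_reflection_descent[OF v ab] \<alpha>
    by (cases rule: linorder_cases[of "weyl_inv ?v \<tau> a" "weyl_inv ?v \<tau> b"]) auto
  moreover have "weyl_mult (reflection \<alpha>) ?v \<in> weyl_group"
    using v by auto
  ultimately show ?case using Cons by (simp add: weyl_word_Cons)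
qed

text \<open>The least \<open>x\<close> with \<open>f x < x\<close> would be mapped to a still
  smaller such element.\<close>

lemma strict_mono_ge_self:
  fixes f :: "'n::{finite,linorder} \<Rightarrow> 'n"
  assumes "strict_mono f"
  shows "x \<le> f x"
proof (rule ccontr)
  let ?S = "{x. f x < x}"
  assume "\<not> x \<le> f x"
  then have ne: "?S \<noteq> {}" using not_le by blast
  have "Min ?S \<in> ?S" using ne by (intro Min_in) auto
  then have "f (Min ?S) \<in> ?S" using assms by (auto simp: strict_mono_def)
  then have "Min ?S \<le> f (Min ?S)" by (intro Min_le) auto
  then show False using \<open>Min ?S \<in> ?S\<close> by auto
qed

text \<open>Without descents both \<open>w\<close> and its inverse are increasing in each factor, so
  neither can lower an index.\<close>

lemma weyl_eq_id:
  fixes w :: "('s, 'n::{finite,linorder}) weyl"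
  assumes w: "w \<in> weyl_group"
    and asc: "\<And>\<tau> a b. (\<tau>, a, b) \<in> simple_roots \<Longrightarrow> weyl_inv w \<tau> a \<le> weyl_inv w \<tau> b"
  shows "w = (\<lambda>\<tau>. id)"
proof (intro ext)
  fix \<tau> x
  have inj: "weyl_inv w \<tau> i = weyl_inv w \<tau> j \<Longrightarrow> i = j" for i j
    using weyl_inv_simps(1)[OF w] by metis
  have "weyl_inv w \<tau> i \<le> weyl_inv w \<tau> j" if "i < j" for i j
    using that
    by (rule adjacent_chain[where R = "\<lambda>i j. weyl_inv w \<tau> i \<le> weyl_inv w \<tau> j"])
      (auto intro!: asc simp: simple_roots_def)
  then have inv: "strict_mono (weyl_inv w \<tau>)"
    using inj by (metis less_irrefl order_le_less strict_monoI)
  then have "strict_mono (w \<tau>)"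
    using weyl_inv_simps[OF w] by (metis strict_mono_less strict_monoI)
  then have "x \<le> w \<tau> x" "w \<tau> x \<le> weyl_inv w \<tau> (w \<tau> x)"
    using inv strict_mono_ge_self by blast+
  then show "w \<tau> x = id x" using w by simp
qed

text \<open>Sorting by adjacent swaps: each descent yields a simple reflection that removes one
  inversion, and an element without descents is the identity.\<close>

lemma weyl_word_exists:
  fixes w :: "('s::finite, 'n::{finite,linorder}) weyl"
  assumes "w \<in> weyl_group"
  shows "\<exists>\<alpha>s. length \<alpha>s = card (inversions w) \<and> set \<alpha>s \<subseteq> simple_roots \<and> w = weyl_word \<alpha>s"
  using assms
proof (induction "card (inversions w)" arbitrary: w rule: less_induct)
  case less
  show ?case
  proof (cases "\<forall>\<tau> a b. (\<tau>, a, b) \<in> simple_roots \<longrightarrow> weyl_inv w \<tau> a \<le> weyl_inv w \<tau> b")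
    case True
    then have "w = (\<lambda>\<tau>. id)"
      using less.prems by (intro weyl_eq_id) auto
    then show ?thesis by (intro exI[of _ "[]"]) (simp add: weyl_word_Nil inversions_id)
  next
    case False
    then obtain \<tau> a b where ab: "(\<tau>, a, b) \<in> simple_roots" and "weyl_inv w \<tau> b < weyl_inv w \<tau> a"
      by (auto simp: not_le)
    then have card: "card (inversions w) = Suc (card (inversions (weyl_mult (reflection (\<tau>, a, b)) w)))"
      using less.prems by (intro card_inversions_reflection_descent)
    let ?v = "weyl_mult (reflection (\<tau>, a, b)) w"
    have "?v \<in> weyl_group" using less.prems by auto
    then obtain \<alpha>s where "length \<alpha>s = card (inversions ?v)" "set \<alpha>s \<subseteq> simple_roots"
      and v: "?v = weyl_word \<alpha>s"
      using less.hyps[of ?v] card by auto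
    moreover have "w = weyl_word ((\<tau>, a, b) # \<alpha>s)"
      using arg_cong[OF v, of "weyl_mult (reflection (\<tau>, a, b))"] by (simp add: weyl_word_Cons)
    ultimately show ?thesis
      using card ab by (intro exI[of _ "(\<tau>, a, b) # \<alpha>s"]) auto
  qed
qed

lemma weyl_length_eq_card_inversions:
  fixes w :: "('s::finite, 'n::{finite,linorder}) weyl"
  assumes "w \<in> weyl_group"
  shows "weyl_length w = card (inversions w)"
  unfolding weyl_length_def weyl_word_def[symmetric]
  by (rule Least_equality) (use weyl_word_exists[OF assms] inversions_weyl_word_le in blast)+

lemma
  shows longest_in_weyl_group: "(longest :: ('s::finite, 'n::{finite,linorder}) weyl) \<in> weyl_group"
    and longest_antimono: "i < j \<Longrightarrow> weyl_inv (longest :: ('s, 'n) weyl) \<tau> j < weyl_inv longest \<tau> i"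
proof -
  let ?l = "longest :: ('s, 'n) weyl"
  \<comment> \<open>\<open>ARG_MAX\<close> is a true maximiser only for bounded lengths; the number
    of all triples serves as bound.\<close>
  have "weyl_length w < Suc (card (UNIV :: ('s, 'n) root set))" if "w \<in> weyl_group" for w :: "('s, 'n) weyl"
    unfolding weyl_length_eq_card_inversions[OF that] less_Suc_eq_le by (rule card_mono) auto
  then have "\<forall>w :: ('s, 'n) weyl. w \<in> weyl_group \<longrightarrow> weyl_length w < Suc (card (UNIV :: ('s, 'n) root set))"
    by blast
  from arg_max_nat_lemma[of "\<lambda>w. w \<in> weyl_group", OF id_in_weyl_group this]
  have "?l \<in> weyl_group \<and> (\<forall>w :: ('s, 'n) weyl. w \<in> weyl_group \<longrightarrow> weyl_length w \<le> weyl_length ?l)"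
    unfolding longest_def .
  then have l: "?l \<in> weyl_group" and max: "\<And>w :: ('s, 'n) weyl. w \<in> weyl_group \<Longrightarrow> weyl_length w \<le> weyl_length ?l"
    by auto
  show "?l \<in> weyl_group" by (rule l)
  \<comment> \<open>If an adjacent pair were not reversed, its reflection would add an inversion and
    contradict maximality.\<close>
  have step: "weyl_inv ?l \<tau> b < weyl_inv ?l \<tau> a" if ab: "(\<tau>, a, b) \<in> simple_roots" for a b
  proof (rule ccontr)
    assume "\<not> ?thesis"
    moreover have "weyl_inv ?l \<tau> a \<noteq> weyl_inv ?l \<tau> b"
      using weyl_inv_simps(1)[OF l] ab by (metis (no_types, lifting) simple_roots_def case_prodD less_irrefl mem_Collect_eq)
    ultimately have "card (inversions (weyl_mult (reflection (\<tau>, a, b)) ?l)) = Suc (card (inversions ?l))"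
      by (intro card_inversions_reflection l ab) auto
    moreover have "weyl_mult (reflection (\<tau>, a, b)) ?l \<in> weyl_group" using l by auto
    ultimately show False
      using max[of "weyl_mult (reflection (\<tau>, a, b)) ?l"] l by (simp add: weyl_length_eq_card_inversions)
  qed
  show "weyl_inv ?l \<tau> j < weyl_inv ?l \<tau> i" if "i < j"
    using that
    by (rule adjacent_chain[where R = "\<lambda>i j. weyl_inv ?l \<tau> j < weyl_inv ?l \<tau> i"])
      (auto intro!: step simp: simple_roots_def)
qed

section \<open>Weights\<close>

text \<open>Coordinate \<open>i\<close> gains 1 for each larger index and loses 1 for each smaller
  one. As \<open>card {..<i}\<close> is the position of \<open>i\<close> counted from zero, \<rho>
  descends from (n-1)/2 in steps of 1.\<close>

lemma half_sum_eq:
  "half_sum (\<tau> :: 's::finite) (i :: 'n::{finite,linorder})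
     = (of_nat CARD('n) - 1) / 2 - of_nat (card {..<i})"
proof -
  let ?A = "(\<lambda>k. (\<tau>, i, k)) ` {i<..}" and ?B = "(\<lambda>k. (\<tau>, k, i)) ` {..<i}"
  have "root_weight \<alpha> \<tau> i = of_bool (\<alpha> \<in> ?A) - of_bool (\<alpha> \<in> ?B)" if "\<alpha> \<in> pos_roots" for \<alpha>
    using that by (auto simp: root_weight_def pos_roots_def)
  then have "(\<Sum>\<alpha>\<in>pos_roots. root_weight \<alpha> \<tau> i)
      = (\<Sum>\<alpha>\<in>pos_roots. of_bool (\<alpha> \<in> ?A)) - (\<Sum>\<alpha>\<in>pos_roots. of_bool (\<alpha> \<in> ?B))"
    by (simp add: sum_subtractf)
  also have "\<dots> = of_nat (card (pos_roots \<inter> ?A)) - of_nat (card (pos_roots \<inter> ?B))"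
    by (simp add: sum_of_bool_eq)
  also have "pos_roots \<inter> ?A = ?A"
    by (auto simp: pos_roots_def)
  also have "card ?A = card {i<..}"
    by (auto intro!: card_image inj_onI)
  also have "pos_roots \<inter> ?B = ?B"
    by (auto simp: pos_roots_def)
  also have "card ?B = card {..<i}"
    by (auto intro!: card_image inj_onI)
  finally have sum: "(\<Sum>\<alpha>\<in>pos_roots. root_weight \<alpha> \<tau> i) = of_nat (card {i<..}) - of_nat (card {..<i})" .
  have "UNIV = insert i ({i<..} \<union> {..<i})" by auto
  then have "CARD('n) = card (insert i ({i<..} \<union> {..<i}))" by simp
  also have "\<dots> = Suc (card {i<..} + card {..<i})"
    by (subst card_insert_disjoint) (auto intro!: card_Un_disjoint)
  finally show ?thesis
    by (simp add: half_sum_def sum field_simps)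
qed

lemma half_sum_simple_root:
  assumes "(\<tau>, i, j) \<in> simple_roots"
  shows "half_sum \<tau> i - half_sum \<tau> j = 1"
proof -
  have "{..<j} = insert i {..<i}"
    using assms by (auto simp: simple_roots_def dest: linorder_neqE)
  then show ?thesis by (simp add: half_sum_eq)
qed

text \<open>The weight \<mu> of the overview; on it the dot action becomes the linear
  action.\<close>

definition longest_shift ::
  "('s::finite \<Rightarrow> 'n::{finite,linorder} \<Rightarrow> int) \<Rightarrow> ('s, 'n) weight" where
  "longest_shift lam = weyl_act longest (\<lambda>\<tau> i. int_weight lam \<tau> i + half_sum \<tau> i)"

section \<open>The dot orbit in terms of the shifted weight\<close>

lemma dot_act_longest:
  "dot_act longest (int_weight lam) = (\<lambda>\<tau> i. longest_shift lam \<tau> i - half_sum \<tau> i)"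
  by (simp add: dot_act_def longest_shift_def)

lemma dot_act_mult_longest:
  assumes "w \<in> weyl_group"
  shows "dot_act (weyl_mult w longest) (int_weight lam)
    = (\<lambda>\<tau> i. longest_shift lam \<tau> (weyl_inv w \<tau> i) - half_sum \<tau> i)"
proof -
  have "inv_into UNIV (w \<tau> \<circ> longest \<tau>) = weyl_inv longest \<tau> \<circ> weyl_inv w \<tau>" for \<tau>
    using assms longest_in_weyl_group by (intro o_inv_distrib) (auto simp: weyl_group_def)
  then show ?thesis
    by (simp add: dot_act_def longest_shift_def weyl_act_def weyl_mult_def)
qed

text \<open>The only possibly fractional term, (n-1)/2, is common to all coordinates and
  cancels.\<close>

lemma longest_shift_diff_int: "longest_shift lam \<tau> i - longest_shift lam \<tau> j \<in> \<int>"
  by (auto simp: longest_shift_def weyl_act_def int_weight_def half_sum_eq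
      intro!: Ints_diff Ints_add)

text \<open>Between neighbours \<rho> drops by 1, which compensates the bound -1 on
  \<open>lam\<close>; the sum is weakly decreasing and \<open>longest\<close> reverses the
  order.\<close>

lemma longest_shift_mono:
  assumes dom: "\<forall>(\<tau>, i, j)\<in>simple_roots. lam \<tau> i - lam \<tau> j \<ge> -1" and "i \<le> j"
  shows "longest_shift lam \<tau> i \<le> longest_shift lam \<tau> j"
proof -
  let ?f = "\<lambda>i. int_weight lam \<tau> i + half_sum \<tau> i"
  have step: "?f b \<le> ?f a" if "(\<tau>, a, b) \<in> simple_roots" for a b
  proof -
    have "lam \<tau> b \<le> lam \<tau> a + 1" using dom that by fastforce
    then have "(of_int (lam \<tau> b) :: rat) \<le> of_int (lam \<tau> a + 1)" by (simp only: of_int_le_iff)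
    then show ?thesis using half_sum_simple_root[OF that] by (simp add: int_weight_def)
  qed
  have "?f l \<le> ?f k" if "k < l" for k l
    using that by (rule adjacent_chain[where R = "\<lambda>k l. ?f l \<le> ?f k"])
      (auto intro!: step simp: simple_roots_def)
  then show ?thesis
    using \<open>i \<le> j\<close> longest_antimono[of i j \<tau>] by (cases "i = j") (auto simp: longest_shift_def weyl_act_def)
qed

text \<open>The equality of groups is tested on the transposition of \<open>i\<close> and
  \<open>j\<close>: it fixes the shifted weight iff the two coordinates agree, and it lies in the
  Levi Weyl group iff they share a block.\<close>

lemma longest_shift_eq_iff:
  assumes stab: "levi_weyl_group I = dot_stabilizer (dot_act longest (int_weight lam))"
  shows "longest_shift lam \<tau> i = longest_shift lam \<tau> j \<longleftrightarrow> same_block I \<tau> i j"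
proof -
  let ?t = "reflection (\<tau>, i, j)"
  have "weyl_inv ?t = ?t"
    by (auto simp: reflection_def fun_eq_iff)
  have "?t \<in> dot_stabilizer (dot_act longest (int_weight lam)) \<longleftrightarrow>
      (\<forall>\<sigma> k. longest_shift lam \<sigma> (?t \<sigma> k) = longest_shift lam \<sigma> k)"
    by (simp add: dot_stabilizer_def dot_act_longest dot_act_def[of ?t] weyl_act_def fun_eq_iff
        fun_cong[OF \<open>weyl_inv ?t = ?t\<close>])
  also have "\<dots> \<longleftrightarrow> longest_shift lam \<tau> i = longest_shift lam \<tau> j"
    by (auto simp: reflection_def Transposition.transpose_def)
  finally have "longest_shift lam \<tau> i = longest_shift lam \<tau> j \<longleftrightarrow> ?t \<in> levi_weyl_group I"
    by (simp add: stab)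
  also have "\<dots> \<longleftrightarrow> (\<forall>\<sigma> k. same_block I \<sigma> k (?t \<sigma> k))"
    by (simp add: levi_weyl_group_def)
  also have "\<dots> \<longleftrightarrow> same_block I \<tau> i j"
  proof
    assume "\<forall>\<sigma> k. same_block I \<sigma> k (?t \<sigma> k)"
    then have "same_block I \<tau> i (?t \<tau> i)" by blast
    then show "same_block I \<tau> i j" by (simp add: reflection_def)
  next
    assume ij: "same_block I \<tau> i j"
    then have "same_block I \<tau> j i" by (simp only: same_block_commute)
    with ij show "\<forall>\<sigma> k. same_block I \<sigma> k (?t \<sigma> k)"
      by (simp add: reflection_def Transposition.transpose_def)
  qed
  finally show ?thesis .
qed

lemma levi_dominant_iff:
  assumes dom: "\<forall>(\<tau>, i, j)\<in>simple_roots. lam \<tau> i - lam \<tau> j \<ge> -1"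
    and stab: "levi_weyl_group I = dot_stabilizer (dot_act longest (int_weight lam))"
    and J: "J \<subseteq> simple_roots" and w: "w \<in> weyl_group"
  shows "levi_dominant J (dot_act (weyl_mult w longest) (int_weight lam)) \<longleftrightarrow>
    (\<forall>(\<tau>, i, j)\<in>J. \<not> in_parabolic I \<tau> (weyl_inv w \<tau> i) (weyl_inv w \<tau> j))"
proof -
  let ?m = "longest_shift lam"
  \<comment> \<open>The coordinates increase weakly, with ties exactly within blocks, so comparing
    them recovers the preorder of \<pp>.\<close>
  have le: "?m \<tau> a \<le> ?m \<tau> b \<longleftrightarrow> in_parabolic I \<tau> a b" for \<tau> a b
    using longest_shift_mono[OF dom, of a b \<tau>] longest_shift_mono[OF dom, of b a \<tau>]
      longest_shift_eq_iff[OF stab, of \<tau> a b]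
    using linear[of a b] by (cases "a \<le> b") (auto simp: in_parabolic_def)
  have "coroot_pairing (\<tau>, i, j) (dot_act (weyl_mult w longest) (int_weight lam)) \<ge> 0 \<longleftrightarrow>
      \<not> in_parabolic I \<tau> (weyl_inv w \<tau> i) (weyl_inv w \<tau> j)" if "(\<tau>, i, j) \<in> J" for \<tau> i j
  proof -
    obtain z where z: "?m \<tau> (weyl_inv w \<tau> i) - ?m \<tau> (weyl_inv w \<tau> j) = of_int z"
      using longest_shift_diff_int by (rule Ints_cases)
    have "half_sum \<tau> i - half_sum \<tau> j = 1"
      using that J by (auto intro: half_sum_simple_root)
    \<comment> \<open>The \<open>- 1\<close> is the pairing with \<rho> that the dot action
      subtracts; by integrality nonnegativity of \<open>z - 1\<close> means
      \<open>z > 0\<close>.\<close>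
    then have "coroot_pairing (\<tau>, i, j) (dot_act (weyl_mult w longest) (int_weight lam)) = of_int (z - 1)"
      using z by (simp add: coroot_pairing_def dot_act_mult_longest[OF w])
    moreover have "in_parabolic I \<tau> (weyl_inv w \<tau> i) (weyl_inv w \<tau> j) \<longleftrightarrow> (of_int z :: rat) \<le> 0"
      unfolding le[symmetric] z[symmetric] by simp
    ultimately show ?thesis
      by (simp only: of_int_0_le_iff of_int_le_0_iff) linarith
  qed
  then show ?thesis unfolding levi_dominant_def by fastforce
qed

text \<open>Inside a block of \<open>J\<close> every adjacent pair belongs to \<open>J\<close>, and
  the complement of the preorder is transitive, so the condition propagates along the chain.\<close>

lemma not_in_parabolic_simple_roots_iff:
  fixes I J :: "('s, 'n::{finite,linorder}) root set"
  assumes "J \<subseteq> simple_roots"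
  shows "(\<forall>\<tau> i j. i < j \<longrightarrow> same_block J \<tau> i j \<longrightarrow> \<not> in_parabolic I \<tau> (f \<tau> i) (f \<tau> j)) \<longleftrightarrow>
    (\<forall>(\<tau>, i, j)\<in>J. \<not> in_parabolic I \<tau> (f \<tau> i) (f \<tau> j))" (is "?L \<longleftrightarrow> ?R")
proof
  assume ?L
  then show ?R
    using assms same_block_simple_root[of _ _ _ J] by (fastforce simp: simple_roots_def)
next
  assume ?R
  show ?L
  proof (intro allI impI)
    fix \<tau> i j assume ij: "i < j" "same_block J \<tau> i j"
    show "\<not> in_parabolic I \<tau> (f \<tau> i) (f \<tau> j)"
      using ij(1)
    proof (rule adjacent_chain[where R = "\<lambda>i j. \<not> in_parabolic I \<tau> (f \<tau> i) (f \<tau> j)"])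
      fix a b assume "a < b" "\<not> (\<exists>k. a < k \<and> k < b)" "i \<le> a" "b \<le> j"
      then have "(\<tau>, a, b) \<in> J"
        using ij unfolding same_block_def by (auto simp: simple_roots_def)
      then show "\<not> in_parabolic I \<tau> (f \<tau> a) (f \<tau> b)"
        using \<open>?R\<close> by blast
    qed (rule not_in_parabolic_trans)
  qed
qed

theorem theorem1p6:
  fixes lam :: "'s::finite \<Rightarrow> 'n::{finite,linorder} \<Rightarrow> int"
    and I J :: "('s, 'n) root set"
    and w :: "('s, 'n) weyl"
    and p :: nat
  assumes "Factorial_Ring.prime p"
    and "finite_extension_of_Qp p TYPE('l::field_char_0)"
    and "\<forall>(\<tau>, i, j)\<in>simple_roots. lam \<tau> i - lam \<tau> j \<ge> -1"
    and "I \<subseteq> simple_roots"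
    and "levi_weyl_group I = dot_stabilizer (dot_act longest (int_weight lam))"
    and "J \<subseteq> simple_roots"
    and "w \<in> weyl_group"
  shows "(steinberg_component I w :: ('s, 'l alg_closure, 'n) flag_point set)
           \<subseteq> steinberg_nilradical_locus I J
         \<longleftrightarrow> levi_dominant J (dot_act (weyl_mult w longest) (int_weight lam))"
  unfolding steinberg_component_subset_locus_iff steinberg_cell_subset_locus_iff[OF assms(7)]
    not_in_parabolic_simple_roots_iff[OF assms(6)] levi_dominant_iff[OF assms(3,5,6,7)] ..

end
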